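(* For a prime $p$ and $n\in\mathbb{N}$, let $C_{n,p}$ denote the size of the largest affine cap in $\mathbb{Z}_p^n$, and let $c_p=\lim_{n\to\infty}(C_{n,p})^{1/n}$. Then $$C_{n,11}\gg \frac{5^{n}}{n^{1.5}},\quad C_{n,17}\gg \frac{7^{n}}{n^{2.5}},\quad C_{n,23}\gg \frac{9^{n}}{n^{3.5}},\quad C_{n,29}\gg \frac{10^{n}}{n^{4}}\quad\text{and}\quad C_{n,41}\gg \frac{12^{n}}{n^{5}}.$$ As a consequence, $$c_{11}\geq 5,\quad c_{17}\geq 7,\quad c_{23}\geq 9,\quad c_{29}\geq 10\quad\text{and}\quad c_{41}\geq 12.$$
   Context: For a prime $p$, $\mathbb{Z}_p=\mathbb{Z}/p\mathbb{Z}$ is the field with $p$ elements, and $\mathrm{AG}(n,p)=\mathbb{Z}_p^n$ is the $n$-dimensional affine space over it. An affine cap is a subset $S\subseteq\mathbb{Z}_p^n$ such that no three points of $S$ are collinear, i.e., for any three pairwise distinct points $x,y,z\in S$ the vectors $y-x$ and $z-x$ are linearly independent over $\mathbb{Z}_p$. (Equivalently: for any pairwise distinct $x,y,z\in S$ and any $(a,b,c)\in\mathbb{Z}_p^3\setminus\{(0,0,0)\}$ with $a+b+c=0$ one has $ax+by+cz\neq 0$.) Vinogradov notation: $f(n)\gg g(n)$ means that there exist $C>0$ and $n_0$ such that $f(n)\geq C\,g(n)$ for all $n>n_0$. It is known that the limit $c_p=\lim_{n\to\infty}(C_{n,p})^{1/n}$ exists. *)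

theory Defs
  imports Complex_Main "HOL-Library.FuncSet" "HOL-Number_Theory.Residues"
begin

abbreviation Zmod :: "nat \<Rightarrow> int ring"
  where "Zmod p \<equiv> residue_ring (int p)"

text \<open>Points and vectors of \<open>\<int>\<^sub>p\<^sup>n\<close> are the extensional functions from
  \<open>{..<n}\<close> to the residue ring, so that there are exactly \<open>p ^ n\<close> of them.\<close>

definition AG :: "nat \<Rightarrow> nat \<Rightarrow> (nat \<Rightarrow> int) set"
  where "AG n p = {..<n} \<rightarrow>\<^sub>E carrier (Zmod p)"

definition vec_diff :: "nat \<Rightarrow> nat \<Rightarrow> (nat \<Rightarrow> int) \<Rightarrow> (nat \<Rightarrow> int) \<Rightarrow> (nat \<Rightarrow> int)"
  where "vec_diff n p y x = (\<lambda>i\<in>{..<n}. y i \<ominus>\<^bsub>Zmod p\<^esub> x i)"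

definition lin_indep_pair :: "nat \<Rightarrow> nat \<Rightarrow> (nat \<Rightarrow> int) \<Rightarrow> (nat \<Rightarrow> int) \<Rightarrow> bool"
  where "lin_indep_pair n p u v \<longleftrightarrow>
    (\<forall>a\<in>carrier (Zmod p). \<forall>b\<in>carrier (Zmod p).
      (\<forall>i<n. a \<otimes>\<^bsub>Zmod p\<^esub> u i \<oplus>\<^bsub>Zmod p\<^esub> b \<otimes>\<^bsub>Zmod p\<^esub> v i = \<zero>\<^bsub>Zmod p\<^esub>)
        \<longrightarrow> a = \<zero>\<^bsub>Zmod p\<^esub> \<and> b = \<zero>\<^bsub>Zmod p\<^esub>)"

definition affine_cap :: "nat \<Rightarrow> nat \<Rightarrow> (nat \<Rightarrow> int) set \<Rightarrow> bool"
  where "affine_cap n p S \<longleftrightarrow> S \<subseteq> AG n p \<and>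
    (\<forall>x\<in>S. \<forall>y\<in>S. \<forall>z\<in>S. x \<noteq> y \<and> x \<noteq> z \<and> y \<noteq> z \<longrightarrow>
      lin_indep_pair n p (vec_diff n p y x) (vec_diff n p z x))"

definition max_cap :: "nat \<Rightarrow> nat \<Rightarrow> nat"
  where "max_cap n p = Max (card ` {S. affine_cap n p S})"

text \<open>The maximum is taken over a finite nonempty set.\<close>

lemma finite_affine_caps: "finite {S. affine_cap n p S}"
proof (rule finite_subset)
  show "{S. affine_cap n p S} \<subseteq> Pow (AG n p)"
    by (auto simp: affine_cap_def)
  show "finite (Pow (AG n p))"
    by (simp add: AG_def residue_ring_def finite_PiE)
qed

lemma affine_cap_empty: "affine_cap n p {}"
  by (simp add: affine_cap_def)

definition cap_const :: "nat \<Rightarrow> real"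
  where "cap_const p = lim (\<lambda>n. root n (real (max_cap n p)))"

definition vinogradov_gg :: "(nat \<Rightarrow> real) \<Rightarrow> (nat \<Rightarrow> real) \<Rightarrow> bool"  (infix "\<ggreater>" 50)
  where "f \<ggreater> g \<longleftrightarrow> (\<exists>C>0. \<exists>n0. \<forall>n>n0. f n \<ge> C * g n)"

end

(* Fix a set D of k residues mod p, two of which are merged, and let S be the set of words in D^n
   with prescribed numbers of occurrences of the k - 2 unmerged residues. All words in S then have the
   same value of (sum_i f (x_i)), for every f that agrees on the two merged residues. Suppose that f and
   g are such functions and that f x + g y > f z + g z for all distinct x, y in D and all z in D with
   z = l x + (1 - l) y. Summing over the coordinates shows that no three points of S are collinear with
   ratio l. It suffices to find such f and g for one l in each orbit under permuting the three points,
   and for suitable D a linear program finds them.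

   Since k - 2 counts are prescribed and each is within O(sqrt n) of its mean for at least half of the
   words, some choice of S has at least c k^n / n^((k - 2) / 2) elements.

   The limit of C_{n,p}^(1/n) exists by Fekete's lemma, because products of caps are caps. *)

theory Submission
  imports Defs
begin

section \<open>Caps and lines\<close>

text \<open>Divisibility of integers replaces arithmetic in the residue ring, so \<open>l\<close>
  ranges over all integers and counts only modulo \<open>p\<close>. Ratios 0 and 1 are the
  degenerate ones, with \<open>z\<close> congruent to \<open>y\<close> or to
  \<open>x\<close>.\<close>

definition on_line :: "nat \<Rightarrow> nat \<Rightarrow> int \<Rightarrow> (nat \<Rightarrow> int) \<Rightarrow> (nat \<Rightarrow> int) \<Rightarrow> (nat \<Rightarrow> int) \<Rightarrow> bool"
  where "on_line n p l x y z \<longleftrightarrow> (\<forall>i<n. int p dvd l * x i + (1 - l) * y i - z i)"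

lemma AG_eqI:
  assumes "x \<in> AG n p" "y \<in> AG n p" and "\<And>i. i < n \<Longrightarrow> int p dvd x i - y i"
  shows "x = y"
proof (rule PiE_ext)
  show "x \<in> {..<n} \<rightarrow>\<^sub>E {0..int p - 1}" "y \<in> {..<n} \<rightarrow>\<^sub>E {0..int p - 1}"
    using assms(1,2) by (simp_all add: AG_def residue_ring_def)
  then show "x i = y i" if "i \<in> {..<n}" for i
  proof -
    assume "x \<in> {..<n} \<rightarrow>\<^sub>E {0..int p - 1}" "y \<in> {..<n} \<rightarrow>\<^sub>E {0..int p - 1}"
    then have "x i \<in> {0..int p - 1}" "y i \<in> {0..int p - 1}"
      using that by (auto simp only: PiE_mem)
    moreover have "x i mod int p = y i mod int p"
      using that assms(3)[of i] by (simp add: mod_eq_dvd_iff)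
    ultimately show ?thesis
      by simp
  qed
qed

lemma AG_eqI_mult:
  assumes "prime p" "x \<in> AG n p" "y \<in> AG n p"
    and "\<And>i. i < n \<Longrightarrow> int p dvd c * (x i - y i)" and "\<not> int p dvd c"
  shows "x = y"
proof (rule AG_eqI[OF assms(2,3)])
  fix i assume "i < n"
  then show "int p dvd x i - y i"
    using prime_dvd_multD[of "int p" c "x i - y i"] assms(1,4,5) by simp
qed

text \<open>Reducing the coefficients modulo \<open>p\<close> passes between arbitrary integers and
  elements of the carrier; from here on no ring operation appears.\<close>

lemma lin_indep_pair_vec_diff_iff:
  assumes "prime p"
  shows "lin_indep_pair n p (vec_diff n p y x) (vec_diff n p z x) \<longleftrightarrow>
    (\<forall>a b. (\<forall>i<n. int p dvd a * (y i - x i) + b * (z i - x i)) \<longrightarrow> int p dvd a \<and> int p dvd b)"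
proof -
  have "p > 1" using assms by (rule prime_gt_1_nat)
  then interpret residues "int p" "Zmod p"
    by unfold_locales simp_all
  have diff: "u \<ominus>\<^bsub>Zmod p\<^esub> v = (u - v) mod int p" for u v
    by (simp add: a_minus_def res_neg_eq res_add_eq mod_simps)
  have comb: "a \<otimes>\<^bsub>Zmod p\<^esub> vec_diff n p y x i \<oplus>\<^bsub>Zmod p\<^esub> b \<otimes>\<^bsub>Zmod p\<^esub> vec_diff n p z x i
      = \<zero>\<^bsub>Zmod p\<^esub> \<longleftrightarrow> int p dvd a * (y i - x i) + b * (z i - x i)" if "i < n" for a b i
    using that by (simp add: vec_diff_def diff res_add_eq res_mult_eq res_zero_eq mod_simps dvd_eq_mod_eq_0)
  have car: "carrier (Zmod p) = {0..int p - 1}"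
    by (simp add: residue_ring_def)
  have zero: "a = 0 \<longleftrightarrow> int p dvd a" if "a \<in> {0..int p - 1}" for a
    using that zdvd_not_zless[of a "int p"] by (cases "a = 0") auto
  show ?thesis
  proof
    assume L: "lin_indep_pair n p (vec_diff n p y x) (vec_diff n p z x)"
    show "\<forall>a b. (\<forall>i<n. int p dvd a * (y i - x i) + b * (z i - x i)) \<longrightarrow> int p dvd a \<and> int p dvd b"
    proof (intro allI impI)
      fix a b assume *: "\<forall>i<n. int p dvd a * (y i - x i) + b * (z i - x i)"
      have m: "c mod int p \<in> carrier (Zmod p)" for c
        using \<open>p > 1\<close> by (simp add: car)
      have "\<forall>i<n. int p dvd (a mod int p) * (y i - x i) + (b mod int p) * (z i - x i)"
        using * unfolding dvd_eq_mod_eq_0 by (metis mod_add_eq mod_mult_left_eq)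
      then have "a mod int p = 0 \<and> b mod int p = 0"
        using L[unfolded lin_indep_pair_def, rule_format, OF m m, of a b] comb
        by (simp only: res_zero_eq)
      then show "int p dvd a \<and> int p dvd b"
        by (simp add: dvd_eq_mod_eq_0)
    qed
  next
    assume R: "\<forall>a b. (\<forall>i<n. int p dvd a * (y i - x i) + b * (z i - x i)) \<longrightarrow> int p dvd a \<and> int p dvd b"
    show "lin_indep_pair n p (vec_diff n p y x) (vec_diff n p z x)"
      unfolding lin_indep_pair_def car
    proof (intro ballI impI)
      fix a b assume ab: "a \<in> {0..int p - 1}" "b \<in> {0..int p - 1}"
        and *: "\<forall>i<n. a \<otimes>\<^bsub>Zmod p\<^esub> vec_diff n p y x i \<oplus>\<^bsub>Zmod p\<^esub> b \<otimes>\<^bsub>Zmod p\<^esub> vec_diff n p z x i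
          = \<zero>\<^bsub>Zmod p\<^esub>"
      have "\<forall>i<n. int p dvd a * (y i - x i) + b * (z i - x i)"
        using * comb by blast
      then have "int p dvd a \<and> int p dvd b"
        using R by blast
      then show "a = \<zero>\<^bsub>Zmod p\<^esub> \<and> b = \<zero>\<^bsub>Zmod p\<^esub>"
        using zero[OF ab(1)] zero[OF ab(2)] by (simp only: res_zero_eq)
    qed
  qed
qed

text \<open>A dependency \<open>a (y - x) + b (z - x) = 0\<close> with \<open>b\<close> invertible
  can be solved for \<open>z\<close>, which makes \<open>z\<close> a combination of \<open>x\<close>
  and \<open>y\<close>; if \<open>b = 0\<close> then \<open>x = y\<close> or \<open>a = 0\<close>.
  Concluding \<open>x = y\<close>, instead of assuming distinct points, lets the criterion apply to
  projections that may coincide.\<close>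

lemma affine_cap_iff:
  assumes "prime p"
  shows "affine_cap n p S \<longleftrightarrow> S \<subseteq> AG n p \<and>
    (\<forall>x\<in>S. \<forall>y\<in>S. \<forall>z\<in>S. \<forall>l. \<not> int p dvd l \<and> \<not> int p dvd 1 - l \<and> on_line n p l x y z \<longrightarrow> x = y)"
    (is "?L \<longleftrightarrow> _ \<and> ?R")
proof (cases "S \<subseteq> AG n p")
  case True
  then have AG: "x \<in> AG n p" if "x \<in> S" for x
    using that by auto
  note eqI = AG_eqI_mult[OF assms AG AG]
  have "?L \<longleftrightarrow> ?R"
  proof
    assume L: ?L
    show ?R
    proof (intro ballI allI impI, elim conjE, rule ccontr)
      fix x y z l
      assume S: "x \<in> S" "y \<in> S" "z \<in> S" and l: "\<not> int p dvd l" "\<not> int p dvd 1 - l"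
        and line: "on_line n p l x y z" and "x \<noteq> y"
      have "z \<noteq> x" "z \<noteq> y"
        using line \<open>x \<noteq> y\<close> eqI[OF S(2,1) _ l(2)] eqI[OF S(1,2) _ l(1)]
        by (auto simp: on_line_def algebra_simps)
      then have indep: "lin_indep_pair n p (vec_diff n p y x) (vec_diff n p z x)"
        using L S \<open>x \<noteq> y\<close> by (simp add: affine_cap_def)
      \<comment> \<open>The line equation says \<open>z - x = (1 - l) (y - x)\<close>, a dependency
        in which one coefficient is the unit -1.\<close>
      have "\<forall>i<n. int p dvd (1 - l) * (y i - x i) + (- 1) * (z i - x i)"
        using line by (simp add: on_line_def algebra_simps)
      with indep have "int p dvd - 1"
        unfolding lin_indep_pair_vec_diff_iff[OF assms] by blast
      then show False
        using prime_gt_1_nat[OF assms] by auto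
    qed
  next
    assume R: ?R
    have "lin_indep_pair n p (vec_diff n p y x) (vec_diff n p z x)"
      if S: "x \<in> S" "y \<in> S" "z \<in> S" and ne: "x \<noteq> y" "x \<noteq> z" "y \<noteq> z" for x y z
      unfolding lin_indep_pair_vec_diff_iff[OF assms]
    proof (intro allI impI)
      fix a b assume *: "\<forall>i<n. int p dvd a * (y i - x i) + b * (z i - x i)"
      have "int p dvd b"
      proof (rule ccontr)
        assume b: "\<not> int p dvd b"
        then have "coprime b (int p)"
          using assms prime_imp_coprime[of "int p" b] by (simp add: coprime_commute)
        then obtain c where "[b * c = 1] (mod int p)"
          using cong_solve_coprime_int by blast
        then have c: "int p dvd b * c - 1"
          by (simp add: cong_iff_dvd_diff)
        \<comment> \<open>With \<open>c\<close> inverse to \<open>b\<close>, the dependency reads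
          \<open>z - x = - a c (y - x)\<close>, so \<open>1 - l\<close> must be
          \<open>- a c\<close>.\<close>
        define l where "l = 1 + a * c"
        have line: "int p dvd l * x i + (1 - l) * y i - z i" if "i < n" for i
        proof -
          have "l * x i + (1 - l) * y i - z i =
              (b * c - 1) * (z i - x i) - c * (a * (y i - x i) + b * (z i - x i))"
            by (simp add: l_def algebra_simps)
          then show ?thesis using c * that by simp
        qed
        have "\<not> int p dvd l"
        proof
          assume "int p dvd l"
          have "int p dvd 1 * (z i - y i)" if "i < n" for i
          proof -
            have "1 * (z i - y i) = l * (x i - y i) - (l * x i + (1 - l) * y i - z i)" by (simp add: algebra_simps)
            then show ?thesis using line[OF that] \<open>int p dvd l\<close> by (metis dvd_diff dvd_mult2)
          qed
          from eqI[OF S(3,2) this] ne(3) show False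
            using prime_gt_1_nat[OF assms] by auto
        qed
        moreover have "\<not> int p dvd 1 - l"
        proof
          assume "int p dvd 1 - l"
          have "int p dvd 1 * (z i - x i)" if "i < n" for i
          proof -
            have "1 * (z i - x i) = (1 - l) * (y i - x i) - (l * x i + (1 - l) * y i - z i)" by (simp add: algebra_simps)
            then show ?thesis using line[OF that] \<open>int p dvd 1 - l\<close> by (metis dvd_diff dvd_mult2)
          qed
          from eqI[OF S(3,1) this] ne(2) show False
            using prime_gt_1_nat[OF assms] by auto
        qed
        ultimately show False
          using R S line ne(1) unfolding on_line_def by blast
      qed
      moreover have "int p dvd a"
      proof (rule ccontr)
        assume "\<not> int p dvd a"
        moreover have "int p dvd a * (y i - x i)" if "i < n" for i
          using * that \<open>int p dvd b\<close> dvd_add_left_iff[of "int p" "b * (z i - x i)" "a * (y i - x i)"] by simp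
        ultimately show False
          using eqI[OF S(2,1), of a] ne(1) by blast
      qed
      ultimately show "int p dvd a \<and> int p dvd b" by blast
    qed
    then show ?L
      using True by (simp add: affine_cap_def)
  qed
  then show ?thesis using True by simp
qed (simp add: affine_cap_def)

section \<open>Elementary bounds on the maximal size of a cap\<close>

lemma card_le_max_cap: "affine_cap n p S \<Longrightarrow> card S \<le> max_cap n p"
  unfolding max_cap_def using finite_affine_caps by (intro Max_ge) auto

lemma max_cap_attained: obtains S where "affine_cap n p S" "card S = max_cap n p"
proof -
  have "max_cap n p \<in> card ` {S. affine_cap n p S}"
    unfolding max_cap_def using finite_affine_caps affine_cap_empty[of n p] by (intro Max_in) auto
  then show ?thesis using that by auto
qed

lemma finite_AG: "finite (AG n p)" and card_AG: "card (AG n p) = p ^ n"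
  by (simp_all add: AG_def residue_ring_def finite_PiE card_PiE)

lemma max_cap_le: "max_cap n p \<le> p ^ n"
  using max_cap_attained[of n p]
  by (metis affine_cap_def card_AG card_mono finite_AG)

lemma max_cap_pos:
  assumes "p > 0"
  shows "max_cap n p > 0"
proof -
  have "(\<lambda>i\<in>{..<n}. 0) \<in> AG n p"
    using assms by (auto simp: AG_def residue_ring_def)
  then have "affine_cap n p {\<lambda>i\<in>{..<n}. 0}"
    by (simp add: affine_cap_def)
  from card_le_max_cap[OF this] show ?thesis by simp
qed

section \<open>Existence of the limit\<close>

definition append_words :: "nat \<Rightarrow> nat \<Rightarrow> (nat \<Rightarrow> 'a) \<times> (nat \<Rightarrow> 'a) \<Rightarrow> nat \<Rightarrow> 'a"
  where "append_words m n = (\<lambda>(x, y). \<lambda>i\<in>{..<m + n}. if i < m then x i else y (i - m))"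

lemma append_words_nth:
  "i < m \<Longrightarrow> append_words m n (x, y) i = x i"
  "i < n \<Longrightarrow> append_words m n (x, y) (m + i) = y i"
  by (simp_all add: append_words_def)

lemma append_words_in_AG:
  "x \<in> AG m p \<Longrightarrow> y \<in> AG n p \<Longrightarrow> append_words m n (x, y) \<in> AG (m + n) p"
  by (auto simp: AG_def append_words_def PiE_iff)

lemma inj_on_append_words: "inj_on (append_words m n) (AG m p \<times> AG n p)"
proof (rule inj_onI, clarify)
  fix x y x' y'
  assume AG: "x \<in> AG m p" "y \<in> AG n p" "x' \<in> AG m p" "y' \<in> AG n p"
    and eq: "append_words m n (x, y) = append_words m n (x', y')"
  have "x i = x' i" if "i < m" for i
    using fun_cong[OF eq, of i] that by (simp add: append_words_nth)
  moreover have "y i = y' i" if "i < n" for i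
    using fun_cong[OF eq, of "m + i"] that by (simp add: append_words_nth)
  ultimately show "x = x' \<and> y = y'"
    using AG by (auto intro!: AG_eqI)
qed

text \<open>Both projections of a line with ratio \<open>l\<close> satisfy the line equation with
  the same \<open>l\<close>, so each factor forces the projections of the first two points to
  agree.\<close>

lemma affine_cap_append_words:
  assumes p: "prime p" and S: "affine_cap m p S" and T: "affine_cap n p T"
  shows "affine_cap (m + n) p (append_words m n ` (S \<times> T))"
  unfolding affine_cap_iff[OF p]
proof (intro conjI ballI allI impI)
  show "append_words m n ` (S \<times> T) \<subseteq> AG (m + n) p"
    using S T append_words_in_AG by (fastforce simp: affine_cap_def)
next
  fix u v w l
  assume "u \<in> append_words m n ` (S \<times> T)" "v \<in> append_words m n ` (S \<times> T)"
    "w \<in> append_words m n ` (S \<times> T)"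
    and l: "\<not> int p dvd l \<and> \<not> int p dvd 1 - l \<and> on_line (m + n) p l u v w"
  then obtain x y z x' y' z' where
    eq: "u = append_words m n (x, x')" "v = append_words m n (y, y')" "w = append_words m n (z, z')"
    and mem: "x \<in> S" "y \<in> S" "z \<in> S" "x' \<in> T" "y' \<in> T" "z' \<in> T"
    by (auto simp only: image_iff mem_Times_iff split_paired_all fst_conv snd_conv split_paired_Ex)
  have line: "int p dvd l * u i + (1 - l) * v i - w i" if "i < m + n" for i
    using l that by (simp add: on_line_def)
  have "on_line m p l x y z"
    unfolding on_line_def
  proof (intro allI impI)
    fix i assume "i < m"
    with line[of i] show "int p dvd l * x i + (1 - l) * y i - z i"
      by (simp add: eq append_words_nth)
  qed
  with S mem l have "x = y"
    unfolding affine_cap_iff[OF p] by blast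
  have "on_line n p l x' y' z'"
    unfolding on_line_def
  proof (intro allI impI)
    fix i assume "i < n"
    with line[of "m + i"] show "int p dvd l * x' i + (1 - l) * y' i - z' i"
      by (simp add: eq append_words_nth)
  qed
  with T mem l have "x' = y'"
    unfolding affine_cap_iff[OF p] by blast
  with \<open>x = y\<close> show "u = v"
    by (simp add: eq)
qed

lemma max_cap_add:
  assumes "prime p"
  shows "max_cap m p * max_cap n p \<le> max_cap (m + n) p"
proof -
  obtain S where S: "affine_cap m p S" "card S = max_cap m p"
    by (rule max_cap_attained)
  obtain T where T: "affine_cap n p T" "card T = max_cap n p"
    by (rule max_cap_attained)
  have "inj_on (append_words m n) (S \<times> T)"
    using S T by (intro inj_on_subset[OF inj_on_append_words[of m n p]]) (auto simp: affine_cap_def)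
  then have "card (append_words m n ` (S \<times> T)) = max_cap m p * max_cap n p"
    using S T by (simp add: card_image card_cartesian_product)
  then show ?thesis
    using card_le_max_cap[OF affine_cap_append_words[OF assms S(1) T(1)]] by simp
qed

text \<open>Fekete's lemma in multiplicative form: the limit is the supremum of the roots. To bound
  \<open>a n\<close> from below by a fixed \<open>a m\<close>, divide \<open>n\<close> by
  \<open>m\<close> with remainder; the bound \<open>a (n mod m) \<ge> 1\<close> absorbs the
  remainder.\<close>

lemma supermultiplicative_root_convergent:
  fixes a :: "nat \<Rightarrow> real"
  assumes ge1: "\<And>n. a n \<ge> 1" and super: "\<And>m n. a m * a n \<le> a (m + n)"
    and bound: "\<And>n. a n \<le> B ^ n" and "B \<ge> 0"
  shows "convergent (\<lambda>n. root n (a n))"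
proof -
  let ?r = "\<lambda>n. root n (a n)"
  define L where "L = (SUP m\<in>{0<..}. ?r m)"
  have root_le: "?r m \<le> B" if "m > 0" for m
    using real_root_le_mono[OF that bound[of m]] that \<open>B \<ge> 0\<close> by (simp add: real_root_power_cancel)
  have bdd: "bdd_above (?r ` {0<..})"
    using root_le by (auto intro!: bdd_aboveI)
  have le_L: "?r m \<le> L" if "m > 0" for m
    unfolding L_def using that bdd by (intro cSUP_upper) auto
  have power: "a m ^ q \<le> a (m * q)" for m q
  proof (induction q)
    case 0
    then show ?case using ge1[of 0] by simp
  next
    case (Suc q)
    then have "a m ^ Suc q \<le> a m * a (m * q)"
      using ge1[of m] by (simp add: mult_left_mono)
    also have "\<dots> \<le> a (m * Suc q)"
      using super[of m "m * q"] by simp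
    finally show ?case .
  qed
  have "?r \<longlonglongrightarrow> L"
  proof (rule order_tendstoI)
    fix u assume "L < u"
    then have "?r n < u" if "n > 0" for n
      using le_L[OF that] by simp
    then show "eventually (\<lambda>n. ?r n < u) sequentially"
      using eventually_gt_at_top[of 0] by (rule eventually_mono[rotated])
  next
    fix u assume "u < L"
    then obtain m where m: "m > 0" "u < ?r m"
      unfolding L_def using less_cSUP_iff[OF _ bdd] by auto
    have "?r m > 0"
      using m ge1[of m] by simp
    \<comment> \<open>The remainder costs at most one factor \<open>a m\<close>, whose
      \<open>n\<close>-th root tends to 1.\<close>
    have low: "?r m * root n (1 / a m) \<le> ?r n" if "n > 0" for n
    proof -
      have "?r m ^ n * (1 / a m) \<le> a n"
      proof -
        \<comment> \<open>Rounding \<open>n\<close> up is harmless because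
          \<open>?r m \<ge> 1\<close>, and the exponent then splits into whole blocks of length
          \<open>m\<close>.\<close>
        have "n \<le> m * (n div m) + m"
          using m(1) by (metis add_le_cancel_left div_mult_mod_eq less_imp_le_nat mod_less_divisor mult.commute)
        then have "?r m ^ n \<le> ?r m ^ (m * (n div m) + m)"
          using m ge1[of m] by (intro power_increasing) simp_all
        also have "\<dots> = a m ^ (n div m) * a m"
          using m ge1[of m] by (simp add: power_add power_mult)
        finally have "?r m ^ n * (1 / a m) \<le> a m ^ (n div m)"
          using ge1[of m] by (simp add: field_simps)
        also have "\<dots> \<le> a (m * (n div m))"
          by (rule power)
        also have "\<dots> \<le> a (m * (n div m)) * a (n mod m)"
          using mult_left_mono[OF ge1[of "n mod m"], of "a (m * (n div m))"] ge1[of "m * (n div m)"] by simp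
        also have "\<dots> \<le> a n"
          using super[of "m * (n div m)" "n mod m"] by simp
        finally show ?thesis .
      qed
      from real_root_le_mono[OF that this] show ?thesis
        using that \<open>?r m > 0\<close> by (simp only: real_root_mult real_root_power_cancel less_imp_le)
    qed
    have "(\<lambda>n. ?r m * root n (1 / a m)) \<longlonglongrightarrow> ?r m * 1"
      using ge1[of m] by (intro tendsto_mult tendsto_const LIMSEQ_root_const) simp
    then have "eventually (\<lambda>n. u < ?r m * root n (1 / a m)) sequentially"
      using m(2) by (intro order_tendstoD) simp_all
    then show "eventually (\<lambda>n. u < ?r n) sequentially"
      using eventually_gt_at_top[of 0]
    proof eventually_elim
      case (elim n)
      then show ?case using low[of n] by simp
    qed
  qed
  then show ?thesis
    by (rule convergentI)
qed

text \<open>\<open>lim\<close> is a definite description, so \<open>cap_const\<close> carries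
  information only once convergence is known.\<close>

lemma max_cap_root_tendsto:
  assumes "prime p"
  shows "(\<lambda>n. root n (real (max_cap n p))) \<longlonglongrightarrow> cap_const p"
proof -
  have "convergent (\<lambda>n. root n (real (max_cap n p)))"
  proof (rule supermultiplicative_root_convergent)
    show "real (max_cap n p) \<ge> 1" for n
      using max_cap_pos[OF prime_gt_0_nat[OF assms], of n] by simp
    show "real (max_cap m p) * real (max_cap n p) \<le> real (max_cap (m + n) p)" for m n
      using max_cap_add[OF assms, of m n] by (simp flip: of_nat_mult)
    show "real (max_cap n p) \<le> real p ^ n" for n
      using max_cap_le[of n p] by (simp flip: of_nat_power)
  qed simp
  then show ?thesis
    by (simp add: cap_const_def convergent_LIMSEQ_iff)
qed

text \<open>The \<open>n\<close>-th roots of a constant and of a fixed power of \<open>n\<close>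
  tend to 1, so the polynomial loss disappears in the limit.\<close>

lemma cap_const_ge:
  assumes "prime p" and "k \<ge> 0"
    and gg: "(\<lambda>n. real (max_cap n p)) \<ggreater> (\<lambda>n. k ^ n / real n powr s)"
  shows "cap_const p \<ge> k"
proof -
  obtain C n0 where C: "C > 0"
    and le: "\<And>n. n > n0 \<Longrightarrow> C * (k ^ n / real n powr s) \<le> real (max_cap n p)"
    using gg by (auto simp: vinogradov_gg_def)
  have "(\<lambda>n. root n C * k / root n (real n) powr s) \<longlonglongrightarrow> 1 * k / 1 powr s"
    by (intro tendsto_intros LIMSEQ_root_const LIMSEQ_root C) simp_all
  moreover have "root n C * k / root n (real n) powr s \<le> root n (real (max_cap n p))"
    if "n > n0" for n
  proof -
    have "root n (real n powr s) = root n (real n) powr s"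
      using that by (simp add: root_powr_inverse powr_powr mult.commute)
    then show ?thesis
      using real_root_le_mono[OF _ le[OF that], of n] that \<open>k \<ge> 0\<close>
      by (simp add: real_root_mult real_root_divide real_root_power_cancel)
  qed
  then have "eventually (\<lambda>n. root n C * k / root n (real n) powr s \<le> root n (real (max_cap n p)))
      sequentially"
    by (auto simp: eventually_sequentially intro!: exI[of _ "Suc n0"])
  ultimately show ?thesis
    using max_cap_root_tendsto[OF assms(1)] by (intro tendsto_le[of sequentially]) simp_all
qed

section \<open>Words with prescribed letter counts\<close>

definition letter_count :: "nat \<Rightarrow> (nat \<Rightarrow> 'a) \<Rightarrow> 'a \<Rightarrow> nat"
  where "letter_count n w d = card {i. i < n \<and> w i = d}"

lemma letter_count_eq_sum:
  "real (letter_count n w d) = (\<Sum>i<n. if w i = d then 1 else 0)"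
  unfolding letter_count_def by (subst sum.If_cases) (auto intro!: arg_cong[where f = card])

lemma sum_PiE_lessThan_Suc:
  fixes F :: "(nat \<Rightarrow> 'a) \<Rightarrow> 'b::comm_monoid_add"
  shows "(\<Sum>w\<in>{..<Suc n} \<rightarrow>\<^sub>E D. F w) = (\<Sum>a\<in>D. \<Sum>w\<in>{..<n} \<rightarrow>\<^sub>E D. F (w(n := a)))"
proof -
  have "(\<Sum>w\<in>{..<Suc n} \<rightarrow>\<^sub>E D. F w) = (\<Sum>(a, w)\<in>D \<times> ({..<n} \<rightarrow>\<^sub>E D). F (w(n := a)))"
    unfolding lessThan_Suc PiE_insert_eq
    by (subst sum.reindex[OF inj_combinator]) (simp_all add: case_prod_unfold)
  then show ?thesis
    by (simp add: sum.cartesian_product)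
qed

section \<open>Moments of letter sums over all words\<close>

lemma sum_words_centered:
  fixes t :: "'a \<Rightarrow> real" and n :: nat
  assumes "finite D" and centered: "(\<Sum>a\<in>D. t a) = 0"
  shows "(\<Sum>w\<in>{..<n} \<rightarrow>\<^sub>E D. \<Sum>i<n. t (w i)) = 0"
proof (induction n)
  case (Suc n)
  have "(\<Sum>w\<in>{..<Suc n} \<rightarrow>\<^sub>E D. \<Sum>i<Suc n. t (w i)) =
      (\<Sum>a\<in>D. \<Sum>w\<in>{..<n} \<rightarrow>\<^sub>E D. (\<Sum>i<n. t (w i)) + t a)"
    by (simp add: sum_PiE_lessThan_Suc)
  also have "\<dots> = 0"
    using Suc centered by (simp add: sum.distrib flip: sum_distrib_left)
  finally show ?case .
qed simp

text \<open>Variances of independent letters add: when a letter is appended, the cross term vanishes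
  by centering. The factor \<open>card D\<close> on the left avoids the exponent
  \<open>n - 1\<close>.\<close>

lemma sum_words_centered_square:
  fixes t :: "'a \<Rightarrow> real" and n :: nat
  assumes "finite D" and centered: "(\<Sum>a\<in>D. t a) = 0"
  shows "real (card D) * (\<Sum>w\<in>{..<n} \<rightarrow>\<^sub>E D. (\<Sum>i<n. t (w i))\<^sup>2) =
    real n * real (card D) ^ n * (\<Sum>a\<in>D. (t a)\<^sup>2)"
proof (induction n)
  case (Suc n)
  let ?W = "{..<n} \<rightarrow>\<^sub>E D" and ?V = "\<Sum>a\<in>D. (t a)\<^sup>2"
  let ?X = "\<Sum>w\<in>?W. (\<Sum>i<n. t (w i))\<^sup>2"
  have "(\<Sum>w\<in>{..<Suc n} \<rightarrow>\<^sub>E D. (\<Sum>i<Suc n. t (w i))\<^sup>2) =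
      (\<Sum>a\<in>D. \<Sum>w\<in>?W. ((\<Sum>i<n. t (w i)) + t a)\<^sup>2)"
    by (simp add: sum_PiE_lessThan_Suc)
  also have "\<dots> = (\<Sum>a\<in>D. ?X + 2 * t a * (\<Sum>w\<in>?W. \<Sum>i<n. t (w i)) + real (card ?W) * (t a)\<^sup>2)"
    by (intro sum.cong refl) (simp add: power2_sum sum.distrib sum_distrib_left algebra_simps)
  also have "\<dots> = real (card D) * ?X + real (card D) ^ n * ?V"
    by (simp add: sum_words_centered[OF assms] sum.distrib sum_distrib_left card_PiE)
  finally show ?case
    using Suc by (simp add: algebra_simps)
qed simp

lemma variance_letter_count:
  assumes "finite D" "d \<in> D"
  defines "k \<equiv> real (card D)"
  shows "(\<Sum>w\<in>{..<n} \<rightarrow>\<^sub>E D. (k * real (letter_count n w d) - real n)\<^sup>2) = real n * k ^ n * (k - 1)"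
proof -
  \<comment> \<open>The indicator of \<open>d\<close>, scaled by \<open>k\<close> so that centering
    needs no division.\<close>
  let ?t = "\<lambda>a. k * (if a = d then 1 else 0) - 1"
  have "k > 0"
    using assms card_gt_0_iff by (auto simp: k_def)
  have "(\<Sum>a\<in>D. ?t a) = 0"
    using assms by (simp add: sum_subtractf flip: sum_distrib_left)
  moreover have "(\<Sum>a\<in>D. (?t a)\<^sup>2) = (\<Sum>a\<in>D. (k\<^sup>2 - 2 * k) * (if a = d then 1 else 0) + 1)"
    by (intro sum.cong) (auto simp: power2_eq_square algebra_simps)
  then have "(\<Sum>a\<in>D. (?t a)\<^sup>2) = k\<^sup>2 - 2 * k + k"
    using assms by (simp add: sum.distrib flip: sum_distrib_left)
  then have "(\<Sum>a\<in>D. (?t a)\<^sup>2) = k * (k - 1)"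
    by (simp add: power2_eq_square algebra_simps)
  moreover have "k * real (letter_count n w d) - real n = (\<Sum>i<n. ?t (w i))" for w
    by (simp add: letter_count_eq_sum sum_subtractf flip: sum_distrib_left)
  ultimately have "k * (\<Sum>w\<in>{..<n} \<rightarrow>\<^sub>E D. (k * real (letter_count n w d) - real n)\<^sup>2)
      = real n * k ^ n * (k * (k - 1))"
    using sum_words_centered_square[of D ?t n] assms by simp
  then have "k * (\<Sum>w\<in>{..<n} \<rightarrow>\<^sub>E D. (k * real (letter_count n w d) - real n)\<^sup>2)
      = k * (real n * k ^ n * (k - 1))"
    by (simp add: algebra_simps)
  then show ?thesis
    using \<open>k > 0\<close> by simp
qed

section \<open>Concentration of the counts and the pigeonhole principle\<close>

lemma card_nat_near_le:
  fixes a r :: real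
  assumes "r \<ge> 0"
  shows "finite {c. \<bar>real c - a\<bar> \<le> r}" and "real (card {c. \<bar>real c - a\<bar> \<le> r}) \<le> 2 * r + 1"
proof -
  let ?I = "{\<lceil>a - r\<rceil>..\<lfloor>a + r\<rfloor>}"
  have sub: "{c. \<bar>real c - a\<bar> \<le> r} \<subseteq> nat ` ?I"
  proof
    fix c assume "c \<in> {c. \<bar>real c - a\<bar> \<le> r}"
    then have "int c \<in> ?I"
      by (simp add: ceiling_le_iff le_floor_iff abs_le_iff)
    then have "nat (int c) \<in> nat ` ?I"
      by (rule imageI)
    then show "c \<in> nat ` ?I"
      by simp
  qed
  then show "finite {c. \<bar>real c - a\<bar> \<le> r}"
    by (rule finite_subset) simp
  have "card {c. \<bar>real c - a\<bar> \<le> r} \<le> card ?I"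
    using card_mono[OF _ sub] card_image_le[of ?I nat] by fastforce
  also have "real (card ?I) \<le> 2 * r + 1"
    using assms by simp linarith
  finally show "real (card {c. \<bar>real c - a\<bar> \<le> r}) \<le> 2 * r + 1"
    by simp
qed

text \<open>The number of values is bounded by a real \<open>b\<close>, so that powers of
  \<open>sqrt n\<close> can be inserted without rounding.\<close>

lemma real_pigeonhole:
  assumes "finite A" "finite B" "f ` A \<subseteq> B" "real (card B) \<le> b" "b > 0"
  obtains v where "real (card {a \<in> A. f a = v}) \<ge> real (card A) / b"
proof (rule ccontr)
  assume no: "\<not> thesis"
  then have less: "real (card {a \<in> A. f a = v}) < real (card A) / b" for v
    using that no by (meson not_le)
  then have "A \<noteq> {}"
    by fastforce
  have "card A = (\<Sum>v\<in>f ` A. card {a \<in> A. f a = v})"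
    using sum.image_gen[OF assms(1), of "\<lambda>_. 1::nat" f] by simp
  then have "real (card A) = (\<Sum>v\<in>f ` A. real (card {a \<in> A. f a = v}))"
    by simp
  also have "\<dots> < (\<Sum>v\<in>f ` A. real (card A) / b)"
    using assms \<open>A \<noteq> {}\<close> less by (intro sum_strict_mono) auto
  also have "\<dots> = real (card (f ` A)) * (real (card A) / b)"
    by simp
  also have "\<dots> \<le> b * (real (card A) / b)"
    using assms card_mono[OF assms(2,3)] by (intro mult_right_mono) auto
  finally show False
    using assms by simp
qed

text \<open>By Chebyshev's inequality, half of the words have all counts within \<open>O(\<surd>n)\<close> of their mean,
  which leaves only \<open>O(n powr (card E / 2))\<close> possible count vectors.\<close>

lemma large_letter_count_class:
  assumes D: "finite D" "E \<subseteq> D" "D \<noteq> {}" and "n > 0"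
  obtains v where "real (card {w \<in> {..<n} \<rightarrow>\<^sub>E D. \<forall>d\<in>E. letter_count n w d = v d}) \<ge>
    1 / (2 * 4 ^ card E) * (real (card D) ^ n / real n powr (real (card E) / 2))"
proof -
  define k where "k = real (card D)"
  have "finite E" using D finite_subset by blast
  have "k > 0"
    using D by (simp add: k_def card_gt_0_iff)
  then have "k \<ge> 1"
    by (simp add: k_def)
  have E_le: "real (card E) \<le> k"
    using D by (simp add: k_def card_mono)
  let ?W = "{..<n} \<rightarrow>\<^sub>E D"
  \<comment> \<open>Adding the squared deviations of all letters in \<open>E\<close> lets a single
    Markov bound control every count at once.\<close>
  define Q where "Q w = (\<Sum>d\<in>E. (k * real (letter_count n w d) - real n)\<^sup>2)" for w
  have Q_nonneg: "Q w \<ge> 0" for w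
    unfolding Q_def by (rule sum_nonneg) simp
  have "finite ?W"
    using D by (simp add: finite_PiE)
  have card_W: "real (card ?W) = k ^ n"
    by (simp add: card_PiE k_def)
  \<comment> \<open>The mean of \<open>Q\<close> is \<open>card E * n * (k - 1)\<close>, at most
    \<open>k\<^sup>2 * n\<close>. The threshold is twice this, so at most half of the words exceed
    it.\<close>
  let ?T = "2 * k\<^sup>2 * real n"
  define G where "G = {w \<in> ?W. Q w \<le> ?T}"
  define B where "B = {w \<in> ?W. \<not> Q w \<le> ?T}"
  have fin: "finite G" "finite B"
    using \<open>finite ?W\<close> by (simp_all add: G_def B_def)
  have "real (card B) * ?T = (\<Sum>w\<in>B. ?T)"
    by simp
  also have "\<dots> \<le> (\<Sum>w\<in>B. Q w)"
    by (intro sum_mono) (auto simp: B_def)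
  also have "\<dots> \<le> (\<Sum>w\<in>?W. Q w)"
    using \<open>finite ?W\<close> Q_nonneg by (intro sum_mono2) (auto simp: B_def)
  also have "\<dots> = (\<Sum>d\<in>E. \<Sum>w\<in>?W. (k * real (letter_count n w d) - real n)\<^sup>2)"
    unfolding Q_def by (rule sum.swap)
  also have "\<dots> = (\<Sum>d\<in>E. real n * k ^ n * (k - 1))"
    using D variance_letter_count[OF D(1), folded k_def] by (intro sum.cong) auto
  also have "\<dots> = real (card E) * (real n * k ^ n * (k - 1))"
    by simp
  also have "\<dots> \<le> k * (real n * k ^ n * k)"
    using E_le \<open>k \<ge> 1\<close> by (intro mult_mono) auto
  finally have "(2 * real (card B)) * (k\<^sup>2 * real n) \<le> k ^ n * (k\<^sup>2 * real n)"
    by (simp add: power2_eq_square algebra_simps)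
  then have "2 * real (card B) \<le> k ^ n"
    using \<open>k > 0\<close> \<open>n > 0\<close> by simp
  moreover have "card ?W = card G + card B"
  proof -
    have "?W = G \<union> B" "G \<inter> B = {}"
      unfolding G_def B_def by blast+
    then show ?thesis
      using fin by (simp only: card_Un_disjoint)
  qed
  ultimately have card_G: "real (card G) \<ge> k ^ n / 2"
    using card_W by simp
  define I where "I = {c. \<bar>real c - real n / k\<bar> \<le> sqrt (2 * real n)}"
  have near: "letter_count n w d \<in> I" if "w \<in> G" "d \<in> E" for w d
  proof -
    have "(k * real (letter_count n w d) - real n)\<^sup>2 \<le> Q w"
      unfolding Q_def using \<open>finite E\<close> that(2)
      by (intro member_le_sum[of d E "\<lambda>d. (k * real (letter_count n w d) - real n)\<^sup>2"]) auto
    also have "Q w \<le> ?T"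
      using that(1) by (simp add: G_def)
    finally have "(k * (real (letter_count n w d) - real n / k))\<^sup>2 \<le> k\<^sup>2 * (2 * real n)"
      using \<open>k > 0\<close> by (simp add: right_diff_distrib mult_ac)
    then have "(real (letter_count n w d) - real n / k)\<^sup>2 \<le> 2 * real n"
      using \<open>k > 0\<close> by (simp add: power_mult_distrib)
    then show ?thesis
      using real_le_rsqrt[of "\<bar>real (letter_count n w d) - real n / k\<bar>"] by (simp add: I_def)
  qed
  have "real (card I) \<le> 2 * sqrt (2 * real n) + 1" and "finite I"
    unfolding I_def by (intro card_nat_near_le; simp)+
  \<comment> \<open>Since 9/4 exceeds 2. With \<open>1 \<le> sqrt n\<close> this gives
    \<open>2 * sqrt (2 * n) + 1 \<le> 4 * sqrt n\<close>, the source of the 4 in the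
    constant.\<close>
  moreover have "sqrt (2 * real n) \<le> 3 / 2 * sqrt (real n)"
    by (rule real_le_lsqrt) (simp_all add: power_mult_distrib power2_eq_square)
  moreover have "sqrt (real n) \<ge> 1"
    using \<open>n > 0\<close> by simp
  ultimately have card_I: "real (card I) \<le> 4 * sqrt (real n)"
    by linarith
  let ?f = "\<lambda>w. restrict (letter_count n w) E"
  let ?V = "E \<rightarrow>\<^sub>E I"
  let ?b = "(4 * sqrt (real n)) ^ card E"
  have "finite ?V"
    using \<open>finite E\<close> \<open>finite I\<close> by (simp add: finite_PiE)
  moreover have "?f ` G \<subseteq> ?V"
    using near by auto
  moreover have "real (card ?V) \<le> ?b"
    using \<open>finite E\<close> power_mono[OF card_I, of "card E"] by (simp add: card_PiE)
  moreover have "?b > 0"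
    using \<open>n > 0\<close> by simp
  ultimately obtain v where v: "real (card {w \<in> G. ?f w = v}) \<ge> real (card G) / ?b"
    using real_pigeonhole[OF fin(1)] by blast
  have "{w \<in> G. ?f w = v} \<subseteq> {w \<in> ?W. \<forall>d\<in>E. letter_count n w d = v d}"
  proof (intro subsetI CollectI conjI ballI)
    fix w assume w: "w \<in> {w \<in> G. ?f w = v}"
    then show "w \<in> ?W" unfolding G_def by blast
    fix d assume "d \<in> E"
    then have "letter_count n w d = ?f w d" by simp
    also have "?f w = v" using w by blast
    finally show "letter_count n w d = v d" .
  qed
  then have "card {w \<in> G. ?f w = v} \<le> card {w \<in> ?W. \<forall>d\<in>E. letter_count n w d = v d}"
    using \<open>finite ?W\<close> by (intro card_mono) auto
  moreover have "k ^ n / 2 / ?b \<le> real (card G) / ?b"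
    using card_G by (intro divide_right_mono) auto
  moreover have "?b = 4 ^ card E * real n powr (real (card E) / 2)"
  proof -
    have "sqrt (real n) ^ card E = sqrt (real n) powr real (card E)"
      using powr_realpow[of "sqrt (real n)" "card E"] \<open>n > 0\<close> by simp
    also have "\<dots> = (real n powr (1 / 2)) powr real (card E)"
      by (simp only: powr_half_sqrt of_nat_0_le_iff)
    also have "\<dots> = real n powr (real (card E) / 2)"
      by (simp add: powr_powr)
    finally show ?thesis
      by (simp only: power_mult_distrib)
  qed
  ultimately have "real (card {w \<in> ?W. \<forall>d\<in>E. letter_count n w d = v d}) \<ge>
      1 / (2 * 4 ^ card E) * (k ^ n / real n powr (real (card E) / 2))"
    using v by simp
  then show ?thesis
    using that by (simp add: k_def)
qed

text \<open>Merging the letters \<open>d1\<close> and \<open>d2\<close> saves one count, since the number of occurrences of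
  \<open>d1\<close> or \<open>d2\<close> is determined by the other counts.\<close>

lemma sum_word_eq_if_letter_counts_eq:
  fixes f :: "'a \<Rightarrow> int"
  assumes "finite D" "f d1 = f d2" and x: "x \<in> {..<n} \<rightarrow>\<^sub>E D" and y: "y \<in> {..<n} \<rightarrow>\<^sub>E D"
    and eq: "\<forall>d\<in>D - {d1, d2}. letter_count n x d = letter_count n y d"
  shows "(\<Sum>i<n. f (x i)) = (\<Sum>i<n. f (y i))"
proof -
  have "(\<Sum>i<n. f (w i)) =
      int n * f d1 + (\<Sum>d\<in>D - {d1, d2}. (f d - f d1) * int (letter_count n w d))"
    if w: "w \<in> {..<n} \<rightarrow>\<^sub>E D" for w
  proof -
    \<comment> \<open>The function \<open>f - f d1\<close> vanishes on both merged letters, so only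
      the remaining letters contribute.\<close>
    have "f (w i) = f d1 + (\<Sum>d\<in>D - {d1, d2}. (f d - f d1) * (if w i = d then 1 else 0))"
      if "i < n" for i
    proof -
      have "w i \<in> D" using w that by auto
      then show ?thesis
        using assms(1,2) by (cases "w i \<in> {d1, d2}") (auto simp: if_distrib sum.delta' cong: if_cong)
    qed
    then have "(\<Sum>i<n. f (w i)) =
        (\<Sum>i<n. f d1 + (\<Sum>d\<in>D - {d1, d2}. (f d - f d1) * (if w i = d then 1 else 0)))"
      by (intro sum.cong) auto
    also have "\<dots> = int n * f d1 +
        (\<Sum>d\<in>D - {d1, d2}. \<Sum>i<n. (f d - f d1) * (if w i = d then 1 else 0))"
      by (subst sum.swap) (simp add: sum.distrib)
    also have "\<dots> = int n * f d1 +
        (\<Sum>d\<in>D - {d1, d2}. (f d - f d1) * (\<Sum>i<n. if w i = d then 1 else 0))"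
      by (simp add: sum_distrib_left)
    also have "\<dots> = int n * f d1 + (\<Sum>d\<in>D - {d1, d2}. (f d - f d1) * int (letter_count n w d))"
      unfolding letter_count_def
      by (subst sum.If_cases) (auto intro!: sum.cong arg_cong[where f = card])
    finally show ?thesis .
  qed
  then show ?thesis
    using x y eq by simp
qed

section \<open>Separating functions\<close>

text \<open>Permuting three points on a line replaces the ratio \<open>l\<close> by one of \<open>l\<close>, \<open>1 - l\<close>, \<open>1/l\<close>,
  \<open>1/(1 - l)\<close>, \<open>1 - 1/l\<close> and \<open>l/(l - 1)\<close>; the congruences below state this without division.\<close>

definition ratio_equiv :: "nat \<Rightarrow> int \<Rightarrow> int \<Rightarrow> bool"
  where "ratio_equiv p l r \<longleftrightarrow>
    int p dvd l - r \<or> int p dvd l + r - 1 \<or> int p dvd l * r - 1 \<or> int p dvd l * (1 - r) - 1 \<or>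
    int p dvd (1 - l) * r - 1 \<or> int p dvd (1 - l) * (1 - r) - 1"

text \<open>Each of the six congruences turns the line of ratio \<open>l\<close> through
  \<open>x\<close>, \<open>y\<close>, \<open>z\<close> into a line of ratio \<open>r\<close> through
  the same points in another order.\<close>

lemma on_line_ratio_equiv:
  assumes p: "prime p" and S: "S \<subseteq> AG n p"
    and r: "\<And>x y z. x \<in> S \<Longrightarrow> y \<in> S \<Longrightarrow> z \<in> S \<Longrightarrow> on_line n p r x y z \<Longrightarrow> x = y"
    and lr: "ratio_equiv p l r" and l: "\<not> int p dvd l" "\<not> int p dvd 1 - l"
    and x: "x \<in> S" and y: "y \<in> S" and z: "z \<in> S" and line: "on_line n p l x y z"
  shows "x = y"
proof -
  define e where "e i = l * x i + (1 - l) * y i - z i" for i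
  have e: "int p dvd e i" if "i < n" for i
    using line that by (simp add: on_line_def e_def)
  \<comment> \<open>For four of the orders the hypothesis on \<open>r\<close> identifies
    \<open>z\<close> with \<open>x\<close> or \<open>y\<close>; since \<open>l\<close> and
    \<open>1 - l\<close> are units, all three points then coincide.\<close>
  have zy: "x = y" if "z = y"
  proof (rule AG_eqI_mult[OF p _ _ _ l(1)])
    show "int p dvd l * (x i - y i)" if "i < n" for i
      using e[OF that] by (simp add: e_def \<open>z = y\<close> algebra_simps)
  qed (use S x y in auto)
  have zx: "y = x" if "z = x"
  proof (rule AG_eqI_mult[OF p _ _ _ l(2)])
    show "int p dvd (1 - l) * (y i - x i)" if "i < n" for i
      using e[OF that] by (simp add: e_def \<open>z = x\<close> algebra_simps)
  qed (use S x y in auto)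
  \<comment> \<open>The defect of the reordered line is a multiple of \<open>e\<close> plus
    \<open>c (y - x)\<close>, where \<open>c\<close> is, up to sign, the quantity that the
    congruence declares divisible by \<open>p\<close>.\<close>
  have lineI: "on_line n p r u v w"
    if "int p dvd c" "\<And>i. r * u i + (1 - r) * v i - w i = a * e i + c * (y i - x i)" for u v w a c
    unfolding on_line_def using that e by simp
  from lr consider "int p dvd l - r" | "int p dvd l + r - 1" | "int p dvd l * r - 1"
    | "int p dvd l * (1 - r) - 1" | "int p dvd (1 - l) * r - 1" | "int p dvd (1 - l) * (1 - r) - 1"
    unfolding ratio_equiv_def by blast
  then show ?thesis
  proof cases
    case 1
    from lineI[OF this, of x y z 1] r[OF x y z] show ?thesis
      by (simp add: e_def algebra_simps)
  next
    case 2
    from lineI[OF this, of y x z 1] r[OF y x z] show ?thesis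
      by (simp add: e_def algebra_simps)
  next
    case 3
    then have "int p dvd - (l * r - 1)" by (simp only: dvd_minus_iff)
    from lineI[OF this, of z y x "- r"] r[OF z y x] zy show ?thesis
      by (simp add: e_def algebra_simps)
  next
    case 4
    then have "int p dvd - (l * (1 - r) - 1)" by (simp only: dvd_minus_iff)
    from lineI[OF this, of y z x "r - 1"] r[OF y z x] zy show ?thesis
      by (simp add: e_def algebra_simps)
  next
    case 5
    from lineI[OF this, of z x y "- r"] r[OF z x y] zx show ?thesis
      by (simp add: e_def algebra_simps)
  next
    case 6
    from lineI[OF this, of x z y "r - 1"] r[OF x z y] zx show ?thesis
      by (simp add: e_def algebra_simps)
  qed
qed

text \<open>For fixed \<open>r\<close> these are finitely many strict linear inequalities in the
  values of \<open>f\<close> and \<open>g\<close>, hence a linear program. Pairs with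
  \<open>x = y\<close> are excluded because there \<open>z\<close> is congruent to \<open>x\<close>
  and strictness would fail.\<close>

definition separating :: "nat \<Rightarrow> int set \<Rightarrow> int \<Rightarrow> (int \<Rightarrow> int) \<Rightarrow> (int \<Rightarrow> int) \<Rightarrow> bool"
  where "separating p D r f g \<longleftrightarrow> (\<forall>x\<in>D. \<forall>y\<in>D. \<forall>z\<in>D.
    x \<noteq> y \<and> int p dvd r * x + (1 - r) * y - z \<longrightarrow> f z + g z < f x + g y)"

text \<open>A coordinate with \<open>x i = y i\<close> has \<open>z i = x i\<close> as well, since
  \<open>D\<close> consists of reduced residues, and contributes equality. Any other coordinate
  contributes a strict inequality, which would contradict the equal totals.\<close>

lemma on_line_separating:
  assumes D: "D \<subseteq> {0..<int p}" and sep: "separating p D r f g"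
    and x: "x \<in> {..<n} \<rightarrow>\<^sub>E D" and y: "y \<in> {..<n} \<rightarrow>\<^sub>E D" and z: "z \<in> {..<n} \<rightarrow>\<^sub>E D"
    and f: "(\<Sum>i<n. f (x i)) = (\<Sum>i<n. f (z i))" and g: "(\<Sum>i<n. g (y i)) = (\<Sum>i<n. g (z i))"
    and line: "on_line n p r x y z"
  shows "x = y"
proof (rule ccontr)
  assume "x \<noteq> y"
  then obtain j where j: "j < n" "x j \<noteq> y j"
    using PiE_ext[OF x y] by auto
  have less: "f (z i) + g (z i) < f (x i) + g (y i)" if "i < n" "x i \<noteq> y i" for i
    using sep line that x y z unfolding separating_def on_line_def by (auto simp: PiE_iff)
  have le: "f (z i) + g (z i) \<le> f (x i) + g (y i)" if "i < n" for i
  proof (cases "x i = y i")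
    case True
    have "int p dvd r * x i + (1 - r) * y i - z i"
      using line that by (simp add: on_line_def)
    then have "int p dvd x i - z i"
      by (simp add: True algebra_simps)
    then have "x i mod int p = z i mod int p"
      by (simp add: mod_eq_dvd_iff)
    moreover have "x i \<in> {0..<int p}" "z i \<in> {0..<int p}"
      using D x z that by auto
    ultimately have "x i = z i"
      by simp
    with True show ?thesis by simp
  qed (use less that in force)
  have "(\<Sum>i<n. f (z i) + g (z i)) < (\<Sum>i<n. f (x i) + g (y i))"
    using j less le by (intro sum_strict_mono_ex1) auto
  then show False
    using f g by (simp add: sum.distrib)
qed

text \<open>One set of words serves all ratios: it depends only on \<open>D\<close> and the merged
  letters, and every admissible \<open>f\<close> and \<open>g\<close> has constant sum on it. Only
  the choice of \<open>r\<close>, \<open>f\<close> and \<open>g\<close> varies with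
  \<open>l\<close>.\<close>

lemma max_cap_gg:
  assumes p: "prime p" and D: "D \<subseteq> {0..<int p}" "d1 \<in> D" "d2 \<in> D" "d1 \<noteq> d2"
    and sep: "\<And>l. l \<in> {2..<int p} \<Longrightarrow>
      \<exists>r f g. ratio_equiv p l r \<and> f d1 = f d2 \<and> g d1 = g d2 \<and> separating p D r f g"
  shows "(\<lambda>n. real (max_cap n p)) \<ggreater>
    (\<lambda>n. real (card D) ^ n / real n powr (real (card D - 2) / 2))"
proof -
  have "finite D"
    using D(1) by (rule finite_subset) simp
  define E where "E = D - {d1, d2}"
  have card_E: "card E = card D - 2"
    using D \<open>finite D\<close> by (simp add: E_def card_Diff_subset)
  let ?C = "1 / (2 * 4 ^ card E) :: real"
  have "?C * (real (card D) ^ n / real n powr (real (card D - 2) / 2)) \<le> real (max_cap n p)"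
    if "n > 0" for n
  proof -
    obtain v where v: "?C * (real (card D) ^ n / real n powr (real (card E) / 2)) \<le>
        real (card {w \<in> {..<n} \<rightarrow>\<^sub>E D. \<forall>d\<in>E. letter_count n w d = v d})"
      using large_letter_count_class[of D E n] \<open>finite D\<close> D \<open>n > 0\<close> by (auto simp: E_def)
    let ?S = "{w \<in> {..<n} \<rightarrow>\<^sub>E D. \<forall>d\<in>E. letter_count n w d = v d}"
    have "{..<n} \<rightarrow>\<^sub>E D \<subseteq> AG n p"
      unfolding AG_def residue_ring_def using D(1) by (intro PiE_mono) auto
    then have S_AG: "?S \<subseteq> AG n p" by auto
    have sums: "(\<Sum>i<n. f (x i)) = (\<Sum>i<n. f (y i))"
      if "x \<in> ?S" "y \<in> ?S" "f d1 = f d2" for x y and f :: "int \<Rightarrow> int"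
      using that by (intro sum_word_eq_if_letter_counts_eq[OF \<open>finite D\<close>, of f d1 d2]) (auto simp: E_def)
    have "affine_cap n p ?S"
      unfolding affine_cap_iff[OF p]
    proof (intro conjI S_AG ballI allI impI)
      fix x y z l
      assume S: "x \<in> ?S" "y \<in> ?S" "z \<in> ?S"
        and l: "\<not> int p dvd l \<and> \<not> int p dvd 1 - l \<and> on_line n p l x y z"
      \<comment> \<open>The line depends on \<open>l\<close> only modulo \<open>p\<close>. Residues
        0 and 1 are excluded by hypothesis, which leaves the range covered by
        \<open>sep\<close>.\<close>
      let ?l = "l mod int p"
      have "p > 0" using p by (rule prime_gt_0_nat)
      have "?l \<noteq> 0"
        using l by (simp add: dvd_eq_mod_eq_0)
      moreover have "?l \<noteq> 1"
      proof
        assume "?l = 1"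
        then have "1 - l = - (l div int p) * int p"
          using div_mult_mod_eq[of l "int p"] by (simp add: algebra_simps)
        then show False
          using l by simp
      qed
      moreover have "0 \<le> ?l" "?l < int p"
        using \<open>p > 0\<close> by simp_all
      ultimately have "?l \<in> {2..<int p}"
        by auto
      from sep[OF this] obtain r f g where r: "ratio_equiv p ?l r"
        and fg: "f d1 = f d2" "g d1 = g d2" and sep_r: "separating p D r f g"
        by blast
      have ll: "int p dvd l - ?l"
        by (simp add: mod_eq_dvd_iff[symmetric])
      have r_line: "a = b" if "a \<in> ?S" "b \<in> ?S" "c \<in> ?S" "on_line n p r a b c" for a b c
        using that fg by (intro on_line_separating[OF D(1) sep_r _ _ _ _ _ that(4)] sums) auto
      have line: "on_line n p ?l x y z"
        unfolding on_line_def
      proof (intro allI impI)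
        fix i assume "i < n"
        have "?l * x i + (1 - ?l) * y i - z i = (l * x i + (1 - l) * y i - z i) - (l - ?l) * (x i - y i)"
          by (simp add: algebra_simps)
        then show "int p dvd ?l * x i + (1 - ?l) * y i - z i"
          using l \<open>i < n\<close> ll by (metis dvd_diff dvd_mult2 on_line_def)
      qed
      have ndvd: "\<not> int p dvd ?l" "\<not> int p dvd 1 - ?l"
        using zdvd_not_zless[of ?l "int p"] zdvd_not_zless[of "?l - 1" "int p"] \<open>?l \<in> {2..<int p}\<close>
          dvd_minus_iff[of "int p" "?l - 1"] by auto
      show "x = y"
      proof (rule on_line_ratio_equiv[OF p S_AG _ r ndvd S line])
        show "a = b" if "a \<in> ?S" "b \<in> ?S" "c \<in> ?S" "on_line n p r a b c" for a b c
          using that by (rule r_line)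
      qed
    qed
    from card_le_max_cap[OF this] v show ?thesis
      by (simp add: card_E)
  qed
  then show ?thesis
    unfolding vinogradov_gg_def by (intro exI[of _ ?C] conjI exI[of _ 0]) auto
qed

text \<open>A certificate lists the values on \<open>ds\<close> of the two functions in \<open>separating\<close>. The first two
  entries of \<open>ds\<close> are the merged letters.\<close>

fun valid_certificate :: "nat \<Rightarrow> int list \<Rightarrow> int \<times> int list \<times> int list \<Rightarrow> bool"
  where "valid_certificate p ds (r, fs, gs) \<longleftrightarrow>
    length fs = length ds \<and> length gs = length ds \<and> fs ! 0 = fs ! 1 \<and> gs ! 0 = gs ! 1 \<and>
    (let t = zip ds (zip fs gs) in
      list_all (\<lambda>(x, fx, gx). list_all (\<lambda>(y, fy, gy). x = y \<or>
        (case map_of t ((r * x + (1 - r) * y) mod int p) of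
          None \<Rightarrow> True
        | Some (fz, gz) \<Rightarrow> fz + gz < fx + gy)) t) t)"

text \<open>Every clause is executable, so an instance is settled by evaluation. The last one checks
  that the listed ratios meet the orbit of each nondegenerate \<open>l\<close>.\<close>

definition valid_certificate_list :: "nat \<Rightarrow> int list \<Rightarrow> (int \<times> int list \<times> int list) list \<Rightarrow> bool"
  where "valid_certificate_list p ds cs \<longleftrightarrow>
    2 \<le> length ds \<and> distinct ds \<and> list_all (\<lambda>d. 0 \<le> d \<and> d < int p) ds \<and>
    list_all (valid_certificate p ds) cs \<and>
    list_all (\<lambda>l. list_ex (\<lambda>(r, _). ratio_equiv p l r) cs) [2..int p - 1]"

lemma valid_certificate_separating:
  assumes ds: "distinct ds" "list_all (\<lambda>d. 0 \<le> d \<and> d < int p) ds" "2 \<le> length ds"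
    and valid: "valid_certificate p ds (r, fs, gs)"
  shows "\<exists>f g. f (ds ! 0) = f (ds ! 1) \<and> g (ds ! 0) = g (ds ! 1) \<and> separating p (set ds) r f g"
proof -
  define t where "t = zip ds (zip fs gs)"
  \<comment> \<open>Outside \<open>ds\<close> this is the unspecified \<open>the None\<close>;
    \<open>separating\<close> evaluates the functions on \<open>ds\<close> alone.\<close>
  define f where "f d = fst (the (map_of t d))" for d
  define g where "g d = snd (the (map_of t d))" for d
  have len: "length fs = length ds" "length gs = length ds"
    using valid by simp_all
  have t_nth: "map_of t (ds ! i) = Some (fs ! i, gs ! i)" if "i < length ds" for i
    using that ds(1) len by (simp add: t_def map_of_zip_nth)
  have t_mem: "map_of t d = Some (f d, g d)" "(d, f d, g d) \<in> set t" if "d \<in> set ds" for d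
  proof -
    obtain i where "i < length ds" "d = ds ! i"
      using \<open>d \<in> set ds\<close> by (auto simp: in_set_conv_nth)
    then show "map_of t d = Some (f d, g d)"
      using t_nth by (simp add: f_def g_def)
    then show "(d, f d, g d) \<in> set t"
      by (rule map_of_SomeD)
  qed
  have "f (ds ! 0) = f (ds ! 1)" "g (ds ! 0) = g (ds ! 1)"
    using valid t_nth[of 0] t_nth[of 1] less_le_trans[OF _ ds(3), of 0] less_le_trans[OF _ ds(3), of 1]
    by (simp_all add: f_def g_def)
  moreover have "separating p (set ds) r f g"
    unfolding separating_def
  proof (intro ballI impI, elim conjE)
    fix x y z
    assume mem: "x \<in> set ds" "y \<in> set ds" "z \<in> set ds" and "x \<noteq> y"
      and "int p dvd r * x + (1 - r) * y - z"
    then have "(r * x + (1 - r) * y) mod int p = z mod int p"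
      by (simp add: mod_eq_dvd_iff)
    \<comment> \<open>Elements of \<open>ds\<close> are reduced, so the lookup at this residue finds
      the entry of \<open>z\<close> and the \<open>None\<close> branch does not arise.\<close>
    then have mod: "(r * x + (1 - r) * y) mod int p = z"
      using ds(2) mem(3) by (auto simp: list_all_iff)
    have "\<forall>(x, fx, gx)\<in>set t. \<forall>(y, fy, gy)\<in>set t. x = y \<or>
        (case map_of t ((r * x + (1 - r) * y) mod int p) of
          None \<Rightarrow> True | Some (fz, gz) \<Rightarrow> fz + gz < fx + gy)"
      using valid by (simp add: Let_def list_all_iff t_def)
    from bspec[OF bspec[OF this t_mem(2)[OF mem(1)], simplified] t_mem(2)[OF mem(2)], simplified]
    show "f z + g z < f x + g y"
      using \<open>x \<noteq> y\<close> mod t_mem(1)[OF mem(3)] by simp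
  qed
  ultimately show ?thesis by blast
qed

lemma max_cap_gg_certified:
  assumes p: "prime p" and valid: "valid_certificate_list p ds cs"
  shows "(\<lambda>n. real (max_cap n p)) \<ggreater>
    (\<lambda>n. real (length ds) ^ n / real n powr (real (length ds - 2) / 2))"
proof -
  have ds: "distinct ds" "list_all (\<lambda>d. 0 \<le> d \<and> d < int p) ds" "2 \<le> length ds"
    using valid by (simp_all add: valid_certificate_list_def)
  have "ds ! 0 \<noteq> ds ! 1"
    using nth_eq_iff_index_eq[OF ds(1), of 0 1] ds(3) by linarith
  moreover have "set ds \<subseteq> {0..<int p}" "ds ! 0 \<in> set ds" "ds ! 1 \<in> set ds"
    using ds(2) less_le_trans[OF _ ds(3), of 0] less_le_trans[OF _ ds(3), of 1]
    by (auto simp: list_all_iff)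
  moreover have "\<exists>r f g. ratio_equiv p l r \<and> f (ds ! 0) = f (ds ! 1) \<and> g (ds ! 0) = g (ds ! 1) \<and>
      separating p (set ds) r f g" if "l \<in> {2..<int p}" for l
  proof -
    have "l \<in> set [2..int p - 1]"
      using that by auto
    then obtain r fs gs where "(r, fs, gs) \<in> set cs" "ratio_equiv p l r"
      using valid unfolding valid_certificate_list_def list_all_iff list_ex_iff by fast
    moreover from this have "valid_certificate p ds (r, fs, gs)"
      using valid unfolding valid_certificate_list_def list_all_iff by blast
    ultimately show ?thesis
      using valid_certificate_separating[OF ds] by blast
  qed
  ultimately show ?thesis
    using max_cap_gg[OF p, of "set ds" "ds ! 0" "ds ! 1"] distinct_card[OF ds(1)] by simp
qed

section \<open>Certificates\<close>

text \<open>In each case the merged residues are normalised to 0 and 1, and the ratios represent all orbits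
  of \<open>ratio_equiv\<close>. The residues come from a computer search, the weights from linear programming.\<close>

lemma certificates_11:
  "valid_certificate_list 11 [0, 1, 2, 5, 7]
    [(2, [1, 1, -1, 0, 1],
        [-1, -1, 0, 0, 0]),
     (3, [-1, -1, -2, 0, -2],
        [0, 0, 1, 2, 1])]"
  by code_simp

text \<open>All five primes are 2 modulo 3, so \<open>l\<^sup>2 - l + 1\<close> has no root. The
  \<open>p - 2\<close> ratios therefore split into the orbit of 2, of size three, and
  \<open>(p - 5) / 6\<close> orbits of size six. Each orbit gets one certificate: three here, and 2,
  4, 5 and 7 for the primes 11, 23, 29 and 41.\<close>

lemma certificates_17:
  "valid_certificate_list 17 [0, 1, 2, 4, 11, 12, 15]
    [(2, [3, 3, 1, -3, 1, -1, 3],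
        [-3, -3, -2, 0, -1, 0, -3]),
     (3, [-1, -1, 1, -3, -2, 1, 1],
        [2, 2, 1, 0, 2, -3, -1]),
     (4, [0, 0, -2, 0, -1, 1, -2],
        [1, 1, 2, 0, 2, 1, 0])]"
  by code_simp

lemma certificates_23:
  "valid_certificate_list 23 [0, 1, 2, 3, 5, 6, 17, 18, 22]
    [(2, [8, 8, 6, 2, -8, -6, -6, -8, 6],
        [0, 0, 1, 3, 8, 7, -1, 0, 1]),
     (3, [0, 0, 2, 0, 3, 0, 8, -2, -8],
        [4, 4, -3, 3, -7, 1, -6, -3, 0]),
     (4, [-1, -1, 4, 1, 8, 0, 4, 5, -9],
        [-4, -4, 5, -1, -9, 5, -1, -8, 6]),
     (5, [1, 1, -6, -2, 5, -4, -8, 7, -3],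
        [7, 7, -2, 4, 2, 4, 8, -8, -4])]"
  by code_simp

lemma certificates_29:
  "valid_certificate_list 29 [0, 1, 6, 7, 8, 13, 14, 17, 22, 24]
    [(2, [5, 5, -4, 4, 2, -6, 1, -6, 4, -4],
        [-2, -2, 4, 0, 1, 5, 0, 6, 0, 5]),
     (3, [2, 2, -5, 2, 0, -3, 2, 1, -3, 5],
        [2, 2, 3, 0, -2, -1, 3, 2, 4, -5]),
     (4, [-5, -5, 4, -6, 2, -6, -1, -5, 6, 0],
        [3, 3, -6, 3, -5, 5, -5, 5, 0, 1]),
     (5, [-5, -5, -3, -4, -2, -1, 0, -4, 5, -4],
        [0, 0, -2, 1, 0, 1, 3, 1, -1, -1]),
     (9, [-5, -5, -3, 0, -2, -4, -2, -4, -3, -4],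
        [5, 5, -2, -5, 0, 2, 4, 3, 1, -1])]"
  by code_simp

lemma certificates_41:
  "valid_certificate_list 41 [0, 1, 2, 3, 4, 5, 6, 13, 18, 28, 30, 39]
    [(2, [15, 15, 13, 9, 3, -5, -15, 1, -3, 14, 7, -15],
        [-1, -1, 0, 2, 5, 9, 14, 0, 8, -13, 3, 1]),
     (3, [-2, -2, 7, 3, 8, 2, 2, -3, 2, 3, 11, -11],
        [-3, -3, -9, -11, -7, -9, -6, 1, -4, -6, -9, 4]),
     (4, [11, 11, 4, 5, 3, -7, -8, 13, -4, -3, -12, -3],
        [2, 2, -3, -11, 9, 12, 9, -9, -8, -2, 10, 7]),
     (5, [0, 0, 11, -11, -2, -4, 3, -6, -4, 4, -11, 10],
        [-6, -6, -1, 0, -9, -3, 1, 1, -7, -8, 1, 0]),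
     (6, [-1, -1, 0, 4, -5, 3, 1, -6, -3, -2, -5, -2],
        [-3, -3, 1, 2, -1, 0, -6, 6, 3, 1, 4, 3]),
     (12, [8, 8, 14, 1, 14, -3, -7, -12, 9, -3, 1, 1],
        [-18, -18, -19, 3, 5, 4, -11, 6, -5, -1, -12, -6]),
     (13, [1, 1, -1, -2, -3, -6, 5, -7, -9, 4, 10, -3],
        [2, 2, 10, 0, 5, 0, 0, 9, 9, 2, -1, -7])]"
  by code_simp

section \<open>The bounds for the five primes\<close>

theorem theorem1:
  shows "((\<lambda>n. real (max_cap n 11)) \<ggreater> (\<lambda>n. 5 ^ n / real n powr 1.5) \<and>
          (\<lambda>n. real (max_cap n 17)) \<ggreater> (\<lambda>n. 7 ^ n / real n powr 2.5) \<and>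
          (\<lambda>n. real (max_cap n 23)) \<ggreater> (\<lambda>n. 9 ^ n / real n powr 3.5) \<and>
          (\<lambda>n. real (max_cap n 29)) \<ggreater> (\<lambda>n. 10 ^ n / real n ^ 4) \<and>
          (\<lambda>n. real (max_cap n 41)) \<ggreater> (\<lambda>n. 12 ^ n / real n ^ 5)) \<and>
         (cap_const 11 \<ge> 5 \<and> cap_const 17 \<ge> 7 \<and> cap_const 23 \<ge> 9 \<and>
          cap_const 29 \<ge> 10 \<and> cap_const 41 \<ge> 12)"
proof -
  have primes: "prime (11::nat)" "prime (17::nat)" "prime (23::nat)" "prime (29::nat)" "prime (41::nat)"
    by (simp_all add: prime_nat_numeral_eq)
  have gg11: "(\<lambda>n. real (max_cap n 11)) \<ggreater> (\<lambda>n. 5 ^ n / real n powr 1.5)"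
    using max_cap_gg_certified[OF primes(1) certificates_11] by simp
  have gg17: "(\<lambda>n. real (max_cap n 17)) \<ggreater> (\<lambda>n. 7 ^ n / real n powr 2.5)"
    using max_cap_gg_certified[OF primes(2) certificates_17] by simp
  have gg23: "(\<lambda>n. real (max_cap n 23)) \<ggreater> (\<lambda>n. 9 ^ n / real n powr 3.5)"
    using max_cap_gg_certified[OF primes(3) certificates_23] by simp
  \<comment> \<open>The exponents 4 and 5 are kept as \<open>powr\<close> to fit
    \<open>cap_const_ge\<close>; \<open>powr_numeral\<close> converts them to ordinary powers at the
    end.\<close>
  have gg29: "(\<lambda>n. real (max_cap n 29)) \<ggreater> (\<lambda>n. 10 ^ n / real n powr 4)"
    using max_cap_gg_certified[OF primes(4) certificates_29] by simp
  have gg41: "(\<lambda>n. real (max_cap n 41)) \<ggreater> (\<lambda>n. 12 ^ n / real n powr 5)"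
    using max_cap_gg_certified[OF primes(5) certificates_41] by simp
  show ?thesis
    using gg11 gg17 gg23 gg29 gg41
      cap_const_ge[OF primes(1) _ gg11] cap_const_ge[OF primes(2) _ gg17]
      cap_const_ge[OF primes(3) _ gg23] cap_const_ge[OF primes(4) _ gg29]
      cap_const_ge[OF primes(5) _ gg41]
    by (simp add: powr_numeral)
qed

end
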